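(* With the matrices and cones defined in the context, the (closures of the) monodromy nilpotent cones $\Sigma_o$ and $\tilde\Sigma_o$ glue along the ray $\mathbb{R}_{\ge0}N_2$ (this is a common boundary ray of both closures), but they do not lie on the same two-dimensional plane in $\operatorname{End}(\mathbb{R}^6)$.
   Context: The space $H^3(X^*_{b_o},\mathbb{R})$ is identified with $\mathbb{R}^6$ (column vectors) through an ordered basis $\alpha_0,\alpha_1,\alpha_2,\beta_2,\beta_1,\beta_0$, endomorphisms with $6\times6$ matrices acting on column vectors. $$\mathsf{T}_x=\begin{pmatrix}1&0&0&0&0&0\\1&1&0&0&0&0\\0&0&1&0&0&0\\3&6&6&1&0&0\\1&2&6&0&1&0\\-4&-1&-3&0&-1&1\end{pmatrix},\quad \mathsf{T}_y=\begin{pmatrix}1&0&0&0&0&0\\0&1&0&0&0&0\\1&0&1&0&0&0\\1&6&2&1&0&0\\3&6&6&0&1&0\\-4&-3&-1&-1&0&1\end{pmatrix},$$ $$T_{E_1}=\begin{pmatrix}-1&0&0&0&0&0\\0&1&-6&0&48&0\\0&0&-1&0&0&0\\0&0&0&-1&-6&0\\0&0&0&0&1&0\\0&0&0&0&0&-1\end{pmatrix}.$$ Put $T_x=({}^t\mathsf{T}_x)^{-1}$, $T_y=({}^t\mathsf{T}_y)^{-1}$, $N_1=\log T_x$, $N_2=\log T_y$ (logarithms of unipotent matrices), and $\Sigma_o=\{\lambda_1N_1+\lambda_2N_2\mid\lambda_i\ge0\}$. Put $\tilde T_x=T_{E_1}^{-1}T_xT_{E_1}$, $\tilde T_y=T_{E_1}^{-1}T_yT_{E_1}$,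 $\tilde N_1=\log\tilde T_x$, $\tilde N_2=\log\tilde T_y$, and $\tilde\Sigma_o=\{\lambda_1\tilde N_1+\lambda_2\tilde N_2\mid\lambda_i>0\}$. *)

theory Defs
  imports "HOL-Analysis.Analysis"
begin

text \<open>The space \<open>End(\<real>\<^sup>6)\<close> is the Euclidean space \<open>real^6^6\<close>; matrices act on column vectors and are
  written as the list of their rows. The index type \<open>6\<close> is cyclic, so the sixth index
  is \<open>6 = 0\<close>; \<open>vector\<close> fills the positions \<open>1, 2, \<dots>, 6\<close> in this order.\<close>

definition sfT_x :: "real^6^6" where
  "sfT_x = vector [
     vector [ 1,  0,  0, 0,  0, 0],
     vector [ 1,  1,  0, 0,  0, 0],
     vector [ 0,  0,  1, 0,  0, 0],
     vector [ 3,  6,  6, 1,  0, 0],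
     vector [ 1,  2,  6, 0,  1, 0],
     vector [-4, -1, -3, 0, -1, 1]]"

definition sfT_y :: "real^6^6" where
  "sfT_y = vector [
     vector [ 1,  0,  0,  0, 0, 0],
     vector [ 0,  1,  0,  0, 0, 0],
     vector [ 1,  0,  1,  0, 0, 0],
     vector [ 1,  6,  2,  1, 0, 0],
     vector [ 3,  6,  6,  0, 1, 0],
     vector [-4, -3, -1, -1, 0, 1]]"

definition T_E1 :: "real^6^6" where
  "T_E1 = vector [
     vector [-1, 0,  0,  0,  0,  0],
     vector [ 0, 1, -6,  0, 48,  0],
     vector [ 0, 0, -1,  0,  0,  0],
     vector [ 0, 0,  0, -1, -6,  0],
     vector [ 0, 0,  0,  0,  1,  0],
     vector [ 0, 0,  0,  0,  0, -1]]"

text \<open>The instance of \<open>power\<close> for \<open>real^'n^'n\<close> is the entrywise one, hence a separate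
  power with respect to the matrix product.\<close>

primrec mat_power :: "real^'n^'n \<Rightarrow> nat \<Rightarrow> real^'n^'n" where
  "mat_power A 0 = mat 1"
| "mat_power A (Suc k) = A ** mat_power A k"

text \<open>The series \<open>log A = \<Sum>\<^sub>j\<^sub>\<ge>\<^sub>1 (-1)\<^sup>j\<^sup>+\<^sup>1 (A - 1)\<^sup>j / j\<close> with \<open>j = k + 1\<close>; for unipotent \<open>A\<close>
  only finitely many terms are nonzero.\<close>

definition mat_log :: "real^'n^'n \<Rightarrow> real^'n^'n" where
  "mat_log A = (\<Sum>k. ((-1) ^ k / real (Suc k)) *\<^sub>R mat_power (A - mat 1) (Suc k))"

definition T_x :: "real^6^6" where
  "T_x = matrix_inv (transpose sfT_x)"

definition T_y :: "real^6^6" where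
  "T_y = matrix_inv (transpose sfT_y)"

definition N1 :: "real^6^6" where
  "N1 = mat_log T_x"

definition N2 :: "real^6^6" where
  "N2 = mat_log T_y"

definition Sigma_o :: "(real^6^6) set" where
  "Sigma_o = {l1 *\<^sub>R N1 + l2 *\<^sub>R N2 | l1 l2. l1 \<ge> 0 \<and> l2 \<ge> 0}"

definition tT_x :: "real^6^6" where
  "tT_x = matrix_inv T_E1 ** T_x ** T_E1"

definition tT_y :: "real^6^6" where
  "tT_y = matrix_inv T_E1 ** T_y ** T_E1"

definition tN1 :: "real^6^6" where
  "tN1 = mat_log tT_x"

definition tN2 :: "real^6^6" where
  "tN2 = mat_log tT_y"

definition tSigma_o :: "(real^6^6) set" where
  "tSigma_o = {l1 *\<^sub>R tN1 + l2 *\<^sub>R tN2 | l1 l2. l1 > 0 \<and> l2 > 0}"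

definition ray :: "'a::real_vector \<Rightarrow> 'a set" where
  "ray v = {t *\<^sub>R v | t. t \<ge> 0}"

text \<open>The boundary of a cone is taken relative to its affine hull: a two-dimensional cone
  in \<open>End(\<real>\<^sup>6)\<close> has empty interior, so all of it would lie in its topological frontier.\<close>

definition boundary_ray :: "'a::euclidean_space set \<Rightarrow> 'a set \<Rightarrow> bool" where
  "boundary_ray R C \<longleftrightarrow>
     (\<exists>v. v \<noteq> 0 \<and> R = ray v) \<and> R face_of C \<and> R \<subseteq> rel_frontier C"

end

theory Submission
  imports Defs
begin

text \<open>
  The two cones share the generator \<open>N2\<close>, because \<open>T_E1\<close> commutes with \<open>T_y\<close>: conjugation by
  \<open>T_E1\<close> leaves \<open>T_y\<close> unchanged, so \<open>tN2 = N2\<close> (lemma \<open>tN2_eq\<close>). It does not fix the plane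
  of the first cone: \<open>N1\<close>, \<open>N2\<close> and \<open>tN1\<close> are linearly independent
  (lemma \<open>lin_indep_N1_N2_tN1\<close>).

  These two facts give everything else by geometry that holds for any linearly independent
  \<open>u\<close>, \<open>v\<close>, \<open>w\<close>. A sector is the image of the closed quadrant under an injective linear map,
  hence closed, and it is the closure of the open sector. Comparing coordinates, the sectors
  spanned by \<open>u, v\<close> and by \<open>w, v\<close> meet in the ray of \<open>v\<close> only. That ray is cut out of each
  sector by a supporting hyperplane, so it is a proper face and lies in the relative frontier.
  Finally, a plane that contains the closed sector contains the origin and is therefore a
  linear subspace; containing both sectors, it contains three independent vectors and
  cannot have dimension two.

  The logarithms are finite sums, since the matrices minus the identity have vanishing fourth
  power, and taking them commutes with conjugation. So \<open>tN1\<close> is the conjugate of \<open>N1\<close>, and its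
  first row already shows the independence.
\<close>

section \<open>Two-dimensional sectors\<close>

definition sector :: "'a::real_vector \<Rightarrow> 'a \<Rightarrow> 'a set" where
  "sector u v = {a *\<^sub>R u + b *\<^sub>R v | a b. a \<ge> 0 \<and> b \<ge> 0}"

definition open_sector :: "'a::real_vector \<Rightarrow> 'a \<Rightarrow> 'a set" where
  "open_sector u v = {a *\<^sub>R u + b *\<^sub>R v | a b. a > 0 \<and> b > 0}"

text \<open>Independence of a family rather than of a set: it includes that the members are distinct,
  which independence of the set \<open>{u, v}\<close> would leave open.\<close>

definition lin_indep2 :: "'a::real_vector \<Rightarrow> 'a \<Rightarrow> bool" where
  "lin_indep2 u v \<longleftrightarrow> (\<forall>a b. a *\<^sub>R u + b *\<^sub>R v = 0 \<longrightarrow> a = 0 \<and> b = 0)"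

lemma lin_indep2D:
  assumes "lin_indep2 u v" "a *\<^sub>R u + b *\<^sub>R v = 0"
  shows "a = 0" "b = 0"
  using assms unfolding lin_indep2_def by blast+

definition lin_indep3 :: "'a::real_vector \<Rightarrow> 'a \<Rightarrow> 'a \<Rightarrow> bool" where
  "lin_indep3 u v w \<longleftrightarrow>
     (\<forall>a b c. a *\<^sub>R u + b *\<^sub>R v + c *\<^sub>R w = 0 \<longrightarrow> a = 0 \<and> b = 0 \<and> c = 0)"

lemma lin_indep3D:
  assumes "lin_indep3 u v w" "a *\<^sub>R u + b *\<^sub>R v + c *\<^sub>R w = 0"
  shows "a = 0" "b = 0" "c = 0"
  using assms unfolding lin_indep3_def by blast+

lemma lin_indep3_imp_lin_indep2:
  assumes "lin_indep3 u v w"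
  shows "lin_indep2 u v" "lin_indep2 w v"
proof -
  have "a = 0 \<and> b = 0" if "a *\<^sub>R u + b *\<^sub>R v = 0" for a b
    using that lin_indep3D(1,2)[OF assms, of a b 0] by simp
  then show "lin_indep2 u v"
    unfolding lin_indep2_def by blast
  have "a = 0 \<and> b = 0" if "a *\<^sub>R w + b *\<^sub>R v = 0" for a b
    using that lin_indep3D(2,3)[OF assms, of 0 b a] by (simp add: add.commute)
  then show "lin_indep2 w v"
    unfolding lin_indep2_def by blast
qed

text \<open>An injective linear map between Euclidean spaces commutes with closure, so both claims reduce
  to the quadrant in the coordinate plane.\<close>

lemma
  fixes u v :: "'a::euclidean_space"
  assumes "lin_indep2 u v"
  shows closure_sector: "closure (sector u v) = sector u v"
    and closure_open_sector: "closure (open_sector u v) = sector u v"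
proof -
  define f where "f = (\<lambda>p::real\<times>real. fst p *\<^sub>R u + snd p *\<^sub>R v)"
  have lin: "linear f"
    unfolding f_def by (rule linearI) (auto simp: algebra_simps)
  have "p = 0" if "f p = 0" for p
    using lin_indep2D[OF assms] that by (auto simp: f_def prod_eq_iff)
  then have inj: "inj f"
    using linear_injective_0[OF lin] by blast
  have s: "sector u v = f ` ({0..} \<times> {0..})"
    unfolding sector_def f_def by force
  have o: "open_sector u v = f ` ({0<..} \<times> {0<..})"
    unfolding open_sector_def f_def by force
  show "closure (sector u v) = sector u v"
    unfolding s closure_injective_linear_image[OF lin inj, symmetric] by (simp add: closure_Times)
  show "closure (open_sector u v) = sector u v"
    unfolding s o closure_injective_linear_image[OF lin inj, symmetric] by (simp add: closure_Times)
qed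

lemma ray_subset_sector: "ray v \<subseteq> sector u v"
proof
  fix x assume "x \<in> ray v"
  then obtain t where "t \<ge> 0" "x = 0 *\<^sub>R u + t *\<^sub>R v"
    by (auto simp: ray_def)
  then show "x \<in> sector u v"
    unfolding sector_def by blast
qed

lemma convex_sector: "convex (sector u v)"
  unfolding convex_def
proof (intro ballI allI impI)
  fix x y and s t :: real
  assume "x \<in> sector u v" "y \<in> sector u v" and st: "0 \<le> s" "0 \<le> t" "s + t = 1"
  then obtain a b c d where "x = a *\<^sub>R u + b *\<^sub>R v" "y = c *\<^sub>R u + d *\<^sub>R v"
    and nn: "a \<ge> 0" "b \<ge> 0" "c \<ge> 0" "d \<ge> 0"
    unfolding sector_def by blast
  then have "s *\<^sub>R x + t *\<^sub>R y = (s * a + t * c) *\<^sub>R u + (s * b + t * d) *\<^sub>R v"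
    by (simp add: algebra_simps)
  moreover have "s * a + t * c \<ge> 0" "s * b + t * d \<ge> 0"
    using st nn by auto
  ultimately show "s *\<^sub>R x + t *\<^sub>R y \<in> sector u v"
    unfolding sector_def by blast
qed

text \<open>The hyperplane orthogonal to the component of \<open>u\<close> perpendicular to \<open>v\<close> supports the sector
  and meets it exactly in the ray of \<open>v\<close>. The ray is thus a face, and a proper one because it
  misses \<open>u\<close>; proper faces lie in the relative frontier.\<close>

lemma boundary_ray_sector:
  fixes u v :: "'a::euclidean_space"
  assumes ind: "lin_indep2 u v"
  shows "boundary_ray (ray v) (sector u v)"
proof -
  have "v \<noteq> 0"
    using lin_indep2D(2)[OF ind, of 0 1] by auto
  \<comment> \<open>the component of \<open>u\<close> orthogonal to \<open>v\<close>, scaled by \<open>v \<bullet> v\<close> to avoid a division\<close>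
  define w where "w = (v \<bullet> v) *\<^sub>R u - (u \<bullet> v) *\<^sub>R v"
  have wv: "w \<bullet> v = 0"
    by (simp add: w_def algebra_simps inner_commute)
  have "w \<noteq> 0"
    using lin_indep2D(1)[OF ind, of "v \<bullet> v" "- (u \<bullet> v)"] \<open>v \<noteq> 0\<close> by (auto simp: w_def)
  moreover have "w \<bullet> w = (v \<bullet> v) * (w \<bullet> u)"
    using wv by (subst (2) w_def) (simp add: algebra_simps)
  ultimately have wu: "w \<bullet> u > 0"
    using zero_less_mult_pos[of "v \<bullet> v" "w \<bullet> u"] \<open>v \<noteq> 0\<close> by (metis inner_gt_zero_iff)
  have ray: "sector u v \<inter> {x. w \<bullet> x = 0} = ray v"
  proof
    show "sector u v \<inter> {x. w \<bullet> x = 0} \<subseteq> ray v"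
      using wu by (auto simp: sector_def ray_def inner_add_right wv)
    show "ray v \<subseteq> sector u v \<inter> {x. w \<bullet> x = 0}"
      using ray_subset_sector[of v u] wv by (auto simp: ray_def)
  qed
  have "w \<bullet> x \<ge> 0" if "x \<in> sector u v" for x
    using that wu by (auto simp: sector_def inner_add_right wv)
  then have face: "ray v face_of sector u v"
    using face_of_Int_supporting_hyperplane_ge[OF convex_sector, of u v 0 w] ray by simp
  have "a *\<^sub>R u + b *\<^sub>R v \<in> sector u v" if "a \<ge> 0" "b \<ge> 0" for a b
    using that unfolding sector_def by blast
  from this[of 1 0] have "u \<in> sector u v"
    by simp
  moreover have "u \<notin> ray v"
    using wu wv by (auto simp: ray_def)
  ultimately have "ray v \<subseteq> rel_frontier (sector u v)"
    using face_of_subset_rel_frontier[OF face] by auto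
  then show ?thesis
    unfolding boundary_ray_def using face \<open>v \<noteq> 0\<close> by blast
qed

lemma sector_Int_sector:
  assumes "lin_indep3 u v w"
  shows "sector u v \<inter> sector w v = ray v"
proof
  show "sector u v \<inter> sector w v \<subseteq> ray v"
  proof
    fix x assume "x \<in> sector u v \<inter> sector w v"
    then obtain a b c d where x: "x = a *\<^sub>R u + b *\<^sub>R v" "x = c *\<^sub>R w + d *\<^sub>R v" "b \<ge> 0"
      unfolding sector_def by blast
    then have "a *\<^sub>R u + (b - d) *\<^sub>R v + (- c) *\<^sub>R w = 0"
      by (simp add: algebra_simps)
    then have "a = 0"
      by (rule lin_indep3D(1)[OF assms])
    then show "x \<in> ray v"
      using x by (auto simp: ray_def)
  qed
  show "ray v \<subseteq> sector u v \<inter> sector w v"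
    using ray_subset_sector by blast
qed

text \<open>The origin and \<open>v\<close> come from the closed sector. The open sector does not contain \<open>w\<close>, but it
  contains \<open>w + v\<close>, which is enough once the plane is known to be a subspace.\<close>

lemma no_common_plane:
  fixes u v w :: "'a::euclidean_space"
  assumes ind: "lin_indep3 u v w"
  shows "\<not> (\<exists>P. affine P \<and> aff_dim P = 2 \<and> sector u v \<subseteq> P \<and> open_sector w v \<subseteq> P)"
proof
  assume "\<exists>P. affine P \<and> aff_dim P = 2 \<and> sector u v \<subseteq> P \<and> open_sector w v \<subseteq> P"
  then obtain P where P: "affine P" "aff_dim P = 2" "sector u v \<subseteq> P" "open_sector w v \<subseteq> P"
    by blast
  have mem: "a *\<^sub>R u + b *\<^sub>R v \<in> P" if "a \<ge> 0" "b \<ge> 0" for a b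
    using that P(3) unfolding sector_def by blast
  have "0 \<in> P" "u \<in> P" "v \<in> P"
    using mem[of 0 0] mem[of 1 0] mem[of 0 1] by auto
  have "a *\<^sub>R w + b *\<^sub>R v \<in> P" if "a > 0" "b > 0" for a b
    using that P(4) unfolding open_sector_def by blast
  from this[of 1 1] have "w + v \<in> P"
    by simp
  have sub: "subspace P"
    using P(1) \<open>0 \<in> P\<close> by (simp add: subspace_affine)
  then have "(w + v) - v \<in> P"
    using \<open>w + v \<in> P\<close> \<open>v \<in> P\<close> by (rule subspace_diff)
  then have sP: "{u, v, w} \<subseteq> P"
    using \<open>u \<in> P\<close> \<open>v \<in> P\<close> by simp
  have "u \<noteq> v" "u \<noteq> w" "v \<noteq> w"
    using lin_indep3D(1)[OF ind, of 1 "-1" 0] lin_indep3D(1)[OF ind, of 1 0 "-1"]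
      lin_indep3D(2)[OF ind, of 0 1 "-1"] by auto
  then have card: "card {u, v, w} = 3"
    by simp
  have "independent {u, v, w}"
  proof (rule independent_if_scalars_zero)
    fix f x
    assume "(\<Sum>x\<in>{u, v, w}. f x *\<^sub>R x) = 0" and x: "x \<in> {u, v, w}"
    then have "f u *\<^sub>R u + f v *\<^sub>R v + f w *\<^sub>R w = 0"
      using \<open>u \<noteq> v\<close> \<open>u \<noteq> w\<close> \<open>v \<noteq> w\<close> by (simp add: add.assoc)
    from lin_indep3D[OF ind this] x show "f x = 0"
      by auto
  qed simp
  then have "3 \<le> dim P"
    using independent_card_le_dim[OF sP] card by simp
  then show False
    using P(2) aff_dim_subspace[OF sub] by simp
qed

section \<open>Logarithms of unipotent matrices\<close>

lemma mat_power_add_zero: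
  assumes "mat_power A n = 0"
  shows "mat_power A (k + n) = 0"
  using assms by (induction k) auto

lemma mat_log_unipotent:
  assumes "mat_power (A - mat 1) n = 0"
  shows "mat_log A = (\<Sum>k<n. ((-1) ^ k / real (Suc k)) *\<^sub>R mat_power (A - mat 1) (Suc k))"
  unfolding mat_log_def
proof (rule suminf_finite)
  fix k assume "k \<notin> {..<n}"
  then have "mat_power (A - mat 1) (Suc k) = 0"
    using mat_power_add_zero[OF assms, of "Suc k - n"] by (simp del: mat_power.simps)
  then show "((-1) ^ k / real (Suc k)) *\<^sub>R mat_power (A - mat 1) (Suc k) = 0"
    by (simp del: mat_power.simps)
qed simp

text \<open>The powers are passed as named matrices so that each product is computed only once for
  concrete \<open>A\<close>.\<close>

lemma mat_log_explicit:
  assumes "A - mat 1 = B" "B ** B = C" "B ** C = D" "B ** D = 0"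
  shows "mat_power (A - mat 1) 4 = 0"
    and "mat_log A = B - (1/2) *\<^sub>R C + (1/3) *\<^sub>R D"
proof -
  show nil: "mat_power (A - mat 1) 4 = 0"
    using assms by (simp add: numeral_eq_Suc)
  show "mat_log A = B - (1/2) *\<^sub>R C + (1/3) *\<^sub>R D"
    using assms mat_log_unipotent[OF nil]
    by (simp add: numeral_eq_Suc)
qed

lemma mat_power_conj:
  fixes A P Q :: "real^'n^'n"
  assumes "P ** Q = mat 1" "Q ** P = mat 1"
  shows "mat_power (Q ** A ** P) k = Q ** mat_power A k ** P"
proof (induction k)
  case (Suc k)
  have "mat_power (Q ** A ** P) (Suc k) = Q ** A ** (P ** Q) ** mat_power A k ** P"
    using Suc by (simp add: matrix_mul_assoc)
  then show ?case
    using assms by (simp add: matrix_mul_assoc)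
qed (use assms in simp)

text \<open>Nilpotency makes both logarithms finite sums, so conjugation, being linear and
  multiplicative, passes through term by term without any question of convergence.\<close>

lemma mat_log_conj:
  fixes A P Q :: "real^'n^'n"
  assumes PQ: "P ** Q = mat 1" "Q ** P = mat 1" and nil: "mat_power (A - mat 1) n = 0"
  shows "mat_log (Q ** A ** P) = Q ** mat_log A ** P"
proof -
  let ?c = "\<lambda>X. Q ** X ** P"
  have lin: "linear ?c"
    by (rule linearI) (simp_all add: matrix_matrix_mult_def vec_eq_iff sum.distrib
        distrib_left distrib_right sum_distrib_left sum_distrib_right mult_ac)
  have "?c A - mat 1 = ?c (A - mat 1)"
    using linear_diff[OF lin, of A "mat 1"] PQ by simp
  then have pow: "mat_power (?c A - mat 1) k = ?c (mat_power (A - mat 1) k)" for k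
    by (simp add: mat_power_conj[OF PQ])
  then have "mat_power (?c A - mat 1) n = 0"
    using nil linear_0[OF lin] by simp
  then show ?thesis
    unfolding mat_log_unipotent[OF nil] pow linear_sum[OF lin] linear_scale[OF lin]
    by (simp add: mat_log_unipotent pow del: mat_power.simps)
qed

section \<open>The matrices\<close>

lemma matrix_inv_eqI:
  fixes A B :: "'a::semiring_1^'n^'n"
  assumes "A ** B = mat 1" "B ** A = mat 1"
  shows "matrix_inv A = B"
proof -
  have "A ** matrix_inv A = mat 1 \<and> matrix_inv A ** A = mat 1"
    unfolding matrix_inv_def by (rule someI[of _ B]) (simp add: assms)
  then show ?thesis
    by (metis assms(2) matrix_mul_assoc matrix_mul_lid matrix_mul_rid)
qed

lemma exhaust_6:
  fixes i :: 6
  shows "i = 1 \<or> i = 2 \<or> i = 3 \<or> i = 4 \<or> i = 5 \<or> i = 6"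
proof (induct i)
  case (of_int z)
  then have "z = 0 \<or> z = 1 \<or> z = 2 \<or> z = 3 \<or> z = 4 \<or> z = 5"
    by fastforce
  then show ?case
    by auto
qed

lemma forall_6: "(\<forall>i::6. P i) \<longleftrightarrow> P 1 \<and> P 2 \<and> P 3 \<and> P 4 \<and> P 5 \<and> P 6"
  by (metis exhaust_6)

lemma UNIV_6: "UNIV = {1, 2, 3, 4, 5, 6::6}"
  using exhaust_6 by auto

lemma sum_6: "sum f (UNIV::6 set) = f 1 + f 2 + f 3 + f 4 + f 5 + f 6"
  unfolding UNIV_6 by (simp add: ac_simps)

lemma vector_6:
  "(vector [a, b, c, d, e, f] :: 'a::zero^6) $ 1 = a"
  "(vector [a, b, c, d, e, f] :: 'a^6) $ 2 = b"
  "(vector [a, b, c, d, e, f] :: 'a^6) $ 3 = c"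
  "(vector [a, b, c, d, e, f] :: 'a^6) $ 4 = d"
  "(vector [a, b, c, d, e, f] :: 'a^6) $ 5 = e"
  "(vector [a, b, c, d, e, f] :: 'a^6) $ 6 = f"
  unfolding vector_def by simp_all

lemmas mat6_simps = vec_eq_iff forall_6 sum_6 vector_6 matrix_matrix_mult_def transpose_def mat_def

lemma T_x_eq: "T_x = vector [
     vector [1, -1, 0, 3, 1, 4],
     vector [0, 1, 0, -6, -2, -1],
     vector [0, 0, 1, -6, -6, -3],
     vector [0, 0, 0, 1, 0, 0],
     vector [0, 0, 0, 0, 1, 1],
     vector [0, 0, 0, 0, 0, 1]]"
  unfolding T_x_def
  by (rule matrix_inv_eqI) (simp_all add: sfT_x_def mat6_simps)

lemma
  shows unipotent_T_x: "mat_power (T_x - mat 1) 4 = 0"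
    and N1_eq: "N1 = vector [
        vector [0, -1, 0, 0, 0, 11/3],
        vector [0, 0, 0, -6, -2, 0],
        vector [0, 0, 0, -6, -6, 0],
        vector [0, 0, 0, 0, 0, 0],
        vector [0, 0, 0, 0, 0, 1],
        vector [0, 0, 0, 0, 0, 0]]"
proof -
  define B :: "real^6^6" where "B = vector [
     vector [0, -1, 0, 3, 1, 4],
     vector [0, 0, 0, -6, -2, -1],
     vector [0, 0, 0, -6, -6, -3],
     vector [0, 0, 0, 0, 0, 0],
     vector [0, 0, 0, 0, 0, 1],
     vector [0, 0, 0, 0, 0, 0]]"
  define C :: "real^6^6" where "C = vector [
     vector [0, 0, 0, 6, 2, 2],
     vector [0, 0, 0, 0, 0, -2],
     vector [0, 0, 0, 0, 0, -6],
     vector [0, 0, 0, 0, 0, 0],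
     vector [0, 0, 0, 0, 0, 0],
     vector [0, 0, 0, 0, 0, 0]]"
  define D :: "real^6^6" where "D = vector [
     vector [0, 0, 0, 0, 0, 2],
     vector [0, 0, 0, 0, 0, 0],
     vector [0, 0, 0, 0, 0, 0],
     vector [0, 0, 0, 0, 0, 0],
     vector [0, 0, 0, 0, 0, 0],
     vector [0, 0, 0, 0, 0, 0]]"
  have "T_x - mat 1 = B" "B ** B = C" "B ** C = D" "B ** D = 0"
    by (simp_all add: T_x_eq B_def C_def D_def mat6_simps)
  note log = mat_log_explicit[OF this]
  show "mat_power (T_x - mat 1) 4 = 0"
    by (rule log(1))
  show "N1 = vector [
        vector [0, -1, 0, 0, 0, 11/3],
        vector [0, 0, 0, -6, -2, 0],
        vector [0, 0, 0, -6, -6, 0],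
        vector [0, 0, 0, 0, 0, 0],
        vector [0, 0, 0, 0, 0, 1],
        vector [0, 0, 0, 0, 0, 0]]"
    unfolding N1_def log(2) by (simp add: B_def C_def D_def mat6_simps)
qed

lemma T_y_eq: "T_y = vector [
     vector [1, 0, -1, 1, 3, 4],
     vector [0, 1, 0, -6, -6, -3],
     vector [0, 0, 1, -2, -6, -1],
     vector [0, 0, 0, 1, 0, 1],
     vector [0, 0, 0, 0, 1, 0],
     vector [0, 0, 0, 0, 0, 1]]"
  unfolding T_y_def
  by (rule matrix_inv_eqI) (simp_all add: sfT_y_def mat6_simps)

lemma
  shows unipotent_T_y: "mat_power (T_y - mat 1) 4 = 0"
    and N2_eq: "N2 = vector [
        vector [0, 0, -1, 0, 0, 11/3],
        vector [0, 0, 0, -6, -6, 0],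
        vector [0, 0, 0, -2, -6, 0],
        vector [0, 0, 0, 0, 0, 1],
        vector [0, 0, 0, 0, 0, 0],
        vector [0, 0, 0, 0, 0, 0]]"
proof -
  define B :: "real^6^6" where "B = vector [
     vector [0, 0, -1, 1, 3, 4],
     vector [0, 0, 0, -6, -6, -3],
     vector [0, 0, 0, -2, -6, -1],
     vector [0, 0, 0, 0, 0, 1],
     vector [0, 0, 0, 0, 0, 0],
     vector [0, 0, 0, 0, 0, 0]]"
  define C :: "real^6^6" where "C = vector [
     vector [0, 0, 0, 2, 6, 2],
     vector [0, 0, 0, 0, 0, -6],
     vector [0, 0, 0, 0, 0, -2],
     vector [0, 0, 0, 0, 0, 0],
     vector [0, 0, 0, 0, 0, 0],
     vector [0, 0, 0, 0, 0, 0]]"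
  define D :: "real^6^6" where "D = vector [
     vector [0, 0, 0, 0, 0, 2],
     vector [0, 0, 0, 0, 0, 0],
     vector [0, 0, 0, 0, 0, 0],
     vector [0, 0, 0, 0, 0, 0],
     vector [0, 0, 0, 0, 0, 0],
     vector [0, 0, 0, 0, 0, 0]]"
  have "T_y - mat 1 = B" "B ** B = C" "B ** C = D" "B ** D = 0"
    by (simp_all add: T_y_eq B_def C_def D_def mat6_simps)
  note log = mat_log_explicit[OF this]
  show "mat_power (T_y - mat 1) 4 = 0"
    by (rule log(1))
  show "N2 = vector [
        vector [0, 0, -1, 0, 0, 11/3],
        vector [0, 0, 0, -6, -6, 0],
        vector [0, 0, 0, -2, -6, 0],
        vector [0, 0, 0, 0, 0, 1],
        vector [0, 0, 0, 0, 0, 0],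
        vector [0, 0, 0, 0, 0, 0]]"
    unfolding N2_def log(2) by (simp add: B_def C_def D_def mat6_simps)
qed

lemma
  shows T_E1_inverse_right: "T_E1 ** matrix_inv T_E1 = mat 1"
    and T_E1_inverse_left: "matrix_inv T_E1 ** T_E1 = mat 1"
    and matrix_inv_T_E1: "matrix_inv T_E1 = vector [
        vector [-1, 0, 0, 0, 0, 0],
        vector [0, 1, -6, 0, -48, 0],
        vector [0, 0, -1, 0, 0, 0],
        vector [0, 0, 0, -1, -6, 0],
        vector [0, 0, 0, 0, 1, 0],
        vector [0, 0, 0, 0, 0, -1]]" (is "_ = ?Q")
proof -
  have *: "T_E1 ** ?Q = mat 1" "?Q ** T_E1 = mat 1"
    by (simp_all add: T_E1_def mat6_simps)
  show inv: "matrix_inv T_E1 = ?Q"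
    by (rule matrix_inv_eqI[OF *])
  show "T_E1 ** matrix_inv T_E1 = mat 1" "matrix_inv T_E1 ** T_E1 = mat 1"
    unfolding inv by (rule *)+
qed

lemma tN1_eq_conj: "tN1 = matrix_inv T_E1 ** N1 ** T_E1"
  unfolding tN1_def tT_x_def N1_def
  by (rule mat_log_conj[OF T_E1_inverse_right T_E1_inverse_left unipotent_T_x])

text \<open>Conjugation by \<open>T_E1\<close> fixes \<open>T_y\<close>; this is why the cones have a ray in common.\<close>

lemma tN2_eq: "tN2 = N2"
proof -
  have "T_y ** T_E1 = T_E1 ** T_y"
    by (simp add: T_y_eq T_E1_def mat6_simps)
  then have "tT_y = T_y"
    unfolding tT_y_def by (metis T_E1_inverse_left matrix_mul_assoc matrix_mul_lid)
  then show ?thesis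
    by (simp add: tN2_def N2_def)
qed

lemma tN1_row1: "tN1 $ 1 = vector [0, 1, -6, 0, 48, 11/3]"
  unfolding tN1_eq_conj matrix_inv_T_E1 by (simp add: N1_eq T_E1_def mat6_simps)

text \<open>In the first rows, only \<open>tN1\<close> has a nonzero fifth entry, and the second and third entries
  separate \<open>N1\<close> from \<open>N2\<close>.\<close>

lemma lin_indep_N1_N2_tN1: "lin_indep3 N1 N2 tN1"
  unfolding lin_indep3_def
proof (intro allI impI)
  fix a b c
  assume "a *\<^sub>R N1 + b *\<^sub>R N2 + c *\<^sub>R tN1 = 0"
  then have "(a *\<^sub>R N1 + b *\<^sub>R N2 + c *\<^sub>R tN1) $ 1 $ j = 0" for j
    by simp
  then have entry: "a * N1 $ 1 $ j + b * N2 $ 1 $ j + c * tN1 $ 1 $ j = 0" for j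
    by simp
  have "c = 0"
    using entry[of 5] by (simp add: N1_eq N2_eq tN1_row1 vector_6)
  then show "a = 0 \<and> b = 0 \<and> c = 0"
    using entry[of 2] entry[of 3] by (simp add: N1_eq N2_eq tN1_row1 vector_6)
qed

theorem proposition5p14:
  shows "closure Sigma_o \<inter> closure tSigma_o = ray N2
    \<and> boundary_ray (ray N2) (closure Sigma_o)
    \<and> boundary_ray (ray N2) (closure tSigma_o)
    \<and> \<not> (\<exists>P :: (real^6^6) set. affine P \<and> aff_dim P = 2 \<and>
            Sigma_o \<subseteq> P \<and> tSigma_o \<subseteq> P)"
proof -
  have S: "Sigma_o = sector N1 N2" and tS: "tSigma_o = open_sector tN1 N2"
    unfolding Sigma_o_def tSigma_o_def sector_def open_sector_def tN2_eq by simp_all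
  note ind = lin_indep3_imp_lin_indep2[OF lin_indep_N1_N2_tN1]
  have "closure Sigma_o = sector N1 N2" "closure tSigma_o = sector tN1 N2"
    unfolding S tS by (rule closure_sector[OF ind(1)], rule closure_open_sector[OF ind(2)])
  then show ?thesis
    using sector_Int_sector[OF lin_indep_N1_N2_tN1] boundary_ray_sector[OF ind(1)]
      boundary_ray_sector[OF ind(2)] no_common_plane[OF lin_indep_N1_N2_tN1]
    unfolding S tS by simp
qed

end
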